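(* Let $p\in(0,1)$ and $q=1-p$. For $r>0$, let $K\sim\mathrm{NegBin}(r,p)$ and $U\sim\mathrm{Uniform}(0,1)$ be independent. Then, as $r\to\infty$, $$\mathrm{Median}(K+U)-\frac{rp}{q}=\frac12-\frac{1+p}{6q}+\mathcal{O}_p(r^{-1}).$$
   Context: For real $r>0$, $p\in(0,1)$ and $q=1-p$, $\mathrm{NegBin}(r,p)$ is the law on $\mathbb{N}_0=\{0,1,2,\dots\}$ with probability mass function $P_{r,p}(k)=\frac{\Gamma(r+k)}{\Gamma(r)\,k!}q^r p^k$. The median of a real random variable is $\mathrm{Median}(X)=\inf\{x\in\mathbb{R}:\mathbb{P}(X\le x)\ge\frac12\}$. Notation: $u=\mathcal{O}_p(v)$ means $\limsup_{r\to\infty}|u/v|<C_p$ where the constant $C_p>0$ may depend on $p$ only. *)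

theory Defs
  imports "HOL-Probability.Probability"
begin

definition negbin_mass :: "real \<Rightarrow> real \<Rightarrow> nat \<Rightarrow> real" where
  "negbin_mass r p k = Gamma (r + real k) / (Gamma r * fact k) * (1 - p) powr r * p ^ k"

text \<open>The library's negative binomial law takes a natural number as first parameter; here
  \<open>r\<close> is real.\<close>

definition NegBin :: "real \<Rightarrow> real \<Rightarrow> nat measure" where
  "NegBin r p = density (count_space UNIV) (\<lambda>k. ennreal (negbin_mass r p k))"

definition median :: "'a measure \<Rightarrow> ('a \<Rightarrow> real) \<Rightarrow> real" where
  "median M X = Inf {x. measure M {\<omega> \<in> space M. X \<omega> \<le> x} \<ge> 1 / 2}"

lemma negbin_mass_nonneg:
  assumes "r > 0" "0 < p"
  shows "negbin_mass r p k \<ge> 0"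
  using assms by (auto simp: negbin_mass_def intro!: mult_nonneg_nonneg divide_nonneg_nonneg Gamma_real_nonneg)

lemma negbin_mass_sums:
  assumes "r > 0" "0 < p" "p < 1"
  shows "negbin_mass r p sums 1"
proof -
  have "(\<lambda>k. ((-r) gchoose k) * (-p) ^ k) sums (1 + (-p)) powr (-r)"
    using assms by (intro gen_binomial_real) auto
  then have "(\<lambda>k. (1 - p) powr r * (((-r) gchoose k) * (-p) ^ k)) sums ((1 - p) powr r * (1 - p) powr (-r))"
    by (intro sums_mult) simp
  moreover have "(1 - p) powr r * (1 - p) powr (-r) = 1"
    using assms by (simp add: powr_minus)
  moreover have "(1 - p) powr r * (((-r) gchoose k) * (-p) ^ k) = negbin_mass r p k" for k
  proof -
    have "r \<notin> \<int>\<^sub>\<le>\<^sub>0" using assms by (auto elim!: nonpos_Ints_cases)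
    then have "pochhammer r k = Gamma (r + real k) / Gamma r"
      by (rule pochhammer_Gamma)
    moreover have "((-r) gchoose k) * (-p) ^ k = pochhammer r k / fact k * p ^ k"
    proof -
      have "(-1) ^ k * (-p) ^ k = p ^ k"
        by (subst power_mult_distrib [symmetric]) simp
      then show ?thesis
        by (simp add: gbinomial_pochhammer)
    qed
    ultimately show ?thesis
      by (simp add: negbin_mass_def)
  qed
  ultimately show ?thesis by simp
qed

lemma prob_space_NegBin:
  assumes "r > 0" "0 < p" "p < 1"
  shows "prob_space (NegBin r p)"
proof
  have "emeasure (NegBin r p) (space (NegBin r p)) = (\<Sum>k. ennreal (negbin_mass r p k))"
    by (simp add: NegBin_def emeasure_density nn_integral_count_space_nat)
  also have "\<dots> = ennreal (\<Sum>k. negbin_mass r p k)"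
    using assms negbin_mass_sums[OF assms]
    by (intro suminf_ennreal2) (auto simp: negbin_mass_nonneg sums_iff)
  also have "\<dots> = 1"
    using negbin_mass_sums[OF assms] by (simp add: sums_iff)
  finally show "emeasure (NegBin r p) (space (NegBin r p)) = 1" .
qed

end

theory Submission
  imports Defs
begin

text \<open>
  Between integers the distribution function of \<open>K + U\<close> is linear: at \<open>n + s\<close> with \<open>0 \<le> s < 1\<close> it
  equals \<open>P(K < n) + s * P(K = n)\<close>.  Its slope near the median is therefore \<open>P(K = n)\<close>, and the
  median lies within \<open>O(1 / r)\<close> of \<open>x = r p / q + 1/2 - (1 + p) / (6 q)\<close> as soon as
    \<open>P(K < n) = 1/2 + P(K = n) * (n - x + O(1 / r))\<close>
  holds uniformly for integers \<open>n\<close> at bounded distance from \<open>x\<close> (\<open>negbin_below_expansion\<close>).  All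
  errors are measured relative to \<open>P(K = n)\<close>, so only ratios of point masses matter.

  As a function of the parameter \<open>p\<close>, the probability \<open>P(K < n)\<close> has a derivative proportional to
  \<open>(1 - p) powr (r - 1) * p ^ (n - 1)\<close> (\<open>DERIV_negbin_below\<close>); it decreases from 1 to 0 on the unit
  interval, so it is one minus a Beta distribution function.  With \<open>l = r + n - 2/3\<close> and
  \<open>m = (n - 1/3) / l\<close>, the point \<open>m\<close> is the classical approximation to the median of this Beta law.
  The lemma \<open>beta_median\<close> shows that \<open>P(K < n)\<close>, taken at the parameter \<open>m\<close>, differs from \<open>1/2\<close>
  by \<open>O(1 / r)\<close> point masses.  The value at \<open>p\<close> then follows by moving from \<open>m\<close> to \<open>p\<close> with the
  derivative, and the identity \<open>l * (m - p) = q * (n - x)\<close> produces exactly the constant in the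
  theorem.

  The heart is \<open>beta_median\<close>: the integrals of
  \<open>t powr (l * m - 2/3) * (1 - t) powr (l * (1 - m) - 2/3)\<close> over the two sides of \<open>m\<close> have to agree up
  to order \<open>1 / l\<^sup>2\<close>.  In a suitable fractional linear coordinate \<open>z\<close> with centre \<open>m\<close>, reflecting
  \<open>z\<close> to \<open>- z\<close> almost preserves the measure.  The coordinate is chosen so that the exponent, which is
  multiplied by \<open>l\<close>, has no cubic term; its odd part is then \<open>O(z ^ 5)\<close>.  The shifts \<open>1/3\<close> and
  \<open>2/3\<close> are exactly those for which the remaining factor has no linear term; its odd part is
  \<open>O(z ^ 3)\<close>.  Against a Gaussian of variance of order \<open>1 / l\<close>, both \<open>l * z ^ 5\<close> and \<open>z ^ 3\<close>
  integrate to \<open>O(1 / l\<^sup>2)\<close>, and outside \<open>\<bar>z\<bar> \<le> 1/4\<close> the kernel is exponentially small.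
\<close>

section \<open>A coordinate in which the Beta kernel is almost even\<close>

text \<open>
  A fractional linear coordinate \<open>z\<close> that vanishes at \<open>t = m\<close> has one
  free parameter besides its scale. That parameter is fixed by requiring that the third derivative
  of \<open>m * ln t + (1 - m) * ln (1 - t)\<close> vanish at the centre; the scale only removes
  denominators.
\<close>

definition reflection_chart :: "real \<Rightarrow> real \<Rightarrow> real" where
  "reflection_chart m z = m * (1 + (2 - m) * z) / (1 + (2 * m - 1) * z)"

text \<open>
  With the three factors called \<open>L1\<close>, \<open>L2\<close>, \<open>L3\<close>, the
  coordinate change reads \<open>t = m * L1 / L3\<close> and \<open>1 - t = (1 - m) * L2 /
  L3\<close>. The coefficients of \<open>z\<close> in them add up to zero, so the product has no
  linear term. This cancellation is what makes both the exponent and the density almost even.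
\<close>

definition chart_cubic :: "real \<Rightarrow> real \<Rightarrow> real" where
  "chart_cubic m z = (1 + (2 - m) * z) * (1 - (1 + m) * z) * (1 + (2 * m - 1) * z)"

text \<open>
  The exponent \<open>m * ln t + (1 - m) * ln (1 - t)\<close> in the new coordinate, relative to
  its maximum at the centre (\<open>beta_exponent_chart\<close>).
\<close>

definition chart_exponent :: "real \<Rightarrow> real \<Rightarrow> real" where
  "chart_exponent m z =
     m * ln (1 + (2 - m) * z) + (1 - m) * ln (1 - (1 + m) * z) - ln (1 + (2 * m - 1) * z)"

definition beta_exponent :: "real \<Rightarrow> real \<Rightarrow> real" where
  "beta_exponent m t = m * ln t + (1 - m) * ln (1 - t)"

text \<open>
  The unnormalised Beta density with parameters \<open>a = l * m + 1/3\<close> and \<open>b = l *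
  (1 - m) + 1/3\<close>: the parametrisation by \<open>m = (a - 1/3) / (a + b - 2/3)\<close> puts
  the approximate median at \<open>m\<close>.
\<close>

definition beta_kernel :: "real \<Rightarrow> real \<Rightarrow> real \<Rightarrow> real" where
  "beta_kernel m l t = t powr (l * m - 2/3) * (1 - t) powr (l * (1 - m) - 2/3)"

text \<open>
  The restriction to \<open>\<bar>z\<bar> \<le> 1/4\<close> keeps all three linear forms away from
  zero, uniformly in \<open>m\<close>.
\<close>

lemma chart_factor_bounds:
  fixes m z :: real
  assumes "0 < m" "m < 1" "\<bar>z\<bar> \<le> 1/4"
  shows "1/2 \<le> 1 + (2 - m) * z" "1 + (2 - m) * z \<le> 3/2"
    and "1/2 \<le> 1 - (1 + m) * z" "1 - (1 + m) * z \<le> 3/2"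
    and "3/4 \<le> 1 + (2 * m - 1) * z" "1 + (2 * m - 1) * z \<le> 5/4"
proof -
  have "\<bar>(2 - m) * z\<bar> \<le> 2 * (1/4)" "\<bar>(1 + m) * z\<bar> \<le> 2 * (1/4)" "\<bar>(2 * m - 1) * z\<bar> \<le> 1 * (1/4)"
    unfolding abs_mult using assms by (intro mult_mono; simp)+
  then show "1/2 \<le> 1 + (2 - m) * z" "1 + (2 - m) * z \<le> 3/2"
    and "1/2 \<le> 1 - (1 + m) * z" "1 - (1 + m) * z \<le> 3/2"
    and "3/4 \<le> 1 + (2 * m - 1) * z" "1 + (2 * m - 1) * z \<le> 5/4"
    by linarith+
qed

lemma chart_cubic_bounds:
  assumes "0 < m" "m < 1" "\<bar>z\<bar> \<le> 1/4"
  shows "3/16 \<le> chart_cubic m z" "chart_cubic m z \<le> 3"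
proof -
  note b = chart_factor_bounds[OF assms]
  have "(1/2) * (1/2) * (3/4) \<le> chart_cubic m z"
    unfolding chart_cubic_def using b by (intro mult_mono) auto
  then show "3/16 \<le> chart_cubic m z" by simp
  have "chart_cubic m z \<le> (3/2) * (3/2) * (5/4)"
    unfolding chart_cubic_def using b by (intro mult_mono) auto
  then show "chart_cubic m z \<le> 3" by simp
qed

lemma chart_cubic_odd_part:
  "chart_cubic m z - chart_cubic m (- z) = - 2 * ((2 - m) * (1 + m) * (2 * m - 1)) * z ^ 3"
  unfolding chart_cubic_def by (simp add: power3_eq_cube algebra_simps)

lemma chart_cubic_odd_coeff:
  fixes m :: real
  assumes "0 < m" "m < 1"
  shows "\<bar>(2 - m) * (1 + m) * (2 * m - 1)\<bar> \<le> 4"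
proof -
  have "\<bar>2 - m\<bar> * \<bar>1 + m\<bar> * \<bar>2 * m - 1\<bar> \<le> 2 * 2 * 1"
    using assms by (intro mult_mono) auto
  then show ?thesis by (simp add: abs_mult)
qed

lemma one_minus_reflection_chart:
  assumes "0 < m" "m < 1" "\<bar>z\<bar> \<le> 1/4"
  shows "1 - reflection_chart m z = (1 - m) * (1 - (1 + m) * z) / (1 + (2 * m - 1) * z)"
  using chart_factor_bounds[OF assms] unfolding reflection_chart_def
  by (simp add: field_simps)

lemma reflection_chart_range:
  assumes "0 < m" "m < 1" "\<bar>z\<bar> \<le> 1/4"
  shows "0 < reflection_chart m z" "reflection_chart m z < 1"
proof -
  note b = chart_factor_bounds[OF assms]
  show "0 < reflection_chart m z"
    unfolding reflection_chart_def using b assms by (intro divide_pos_pos mult_pos_pos) auto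
  have "0 < 1 - reflection_chart m z"
    unfolding one_minus_reflection_chart[OF assms] using b assms
    by (intro divide_pos_pos mult_pos_pos) auto
  then show "reflection_chart m z < 1" by simp
qed

lemma reflection_chart_0 [simp]: "reflection_chart m 0 = m"
  by (simp add: reflection_chart_def)

lemma reflection_chart_minus_center:
  assumes "0 < m" "m < 1" "\<bar>z\<bar> \<le> 1/4"
  shows "reflection_chart m z - m = 3 * m * (1 - m) * z / (1 + (2 * m - 1) * z)"
  using chart_factor_bounds[OF assms] unfolding reflection_chart_def
  by (simp add: field_simps)

lemma DERIV_reflection_chart:
  assumes "0 < m" "m < 1" "\<bar>z\<bar> \<le> 1/4"
  shows "(reflection_chart m has_real_derivative 3 * m * (1 - m) / (1 + (2 * m - 1) * z)\<^sup>2) (at z)"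
proof -
  have [simp]: "1 + (2 * m - 1) * z \<noteq> 0"
    using chart_factor_bounds[OF assms] by auto
  have "((\<lambda>z. m * (1 + (2 - m) * z) / (1 + (2 * m - 1) * z)) has_real_derivative
      3 * m * (1 - m) / (1 + (2 * m - 1) * z)\<^sup>2) (at z)"
    by (rule derivative_eq_intros refl | simp)+
       (simp add: power2_eq_square, simp add: algebra_simps)
  then show ?thesis by (simp add: reflection_chart_def[abs_def])
qed

lemma ln_reflection_chart:
  assumes "0 < m" "m < 1" "\<bar>z\<bar> \<le> 1/4"
  shows "ln (reflection_chart m z) = ln m + ln (1 + (2 - m) * z) - ln (1 + (2 * m - 1) * z)"
    and "ln (1 - reflection_chart m z) =
      ln (1 - m) + ln (1 - (1 + m) * z) - ln (1 + (2 * m - 1) * z)"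
proof -
  define x where "x = 1 + (2 - m) * z"
  define y where "y = 1 - (1 + m) * z"
  define w where "w = 1 + (2 * m - 1) * z"
  have pos: "0 < x" "0 < y" "0 < w"
    using chart_factor_bounds[OF assms] by (simp_all add: x_def y_def w_def)
  show "ln (reflection_chart m z) = ln m + ln (1 + (2 - m) * z) - ln (1 + (2 * m - 1) * z)"
    unfolding reflection_chart_def x_def[symmetric] w_def[symmetric]
    using pos assms by (simp add: ln_mult ln_div)
  show "ln (1 - reflection_chart m z) =
      ln (1 - m) + ln (1 - (1 + m) * z) - ln (1 + (2 * m - 1) * z)"
    unfolding one_minus_reflection_chart[OF assms] y_def[symmetric] w_def[symmetric]
    using pos assms by (simp add: ln_mult ln_div)
qed

lemma beta_exponent_chart:
  assumes "0 < m" "m < 1" "\<bar>z\<bar> \<le> 1/4"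
  shows "beta_exponent m (reflection_chart m z) = beta_exponent m m + chart_exponent m z"
  unfolding beta_exponent_def chart_exponent_def ln_reflection_chart[OF assms]
  by (simp add: algebra_simps)

lemma beta_kernel_eq_exp:
  assumes "0 < t" "t < 1"
  shows "beta_kernel m l t = exp ((l * m - 2/3) * ln t + (l * (1 - m) - 2/3) * ln (1 - t))"
  using assms by (simp add: beta_kernel_def powr_def exp_add)

text \<open>
  The derivative of the coordinate change contributes \<open>L3\<close> to the power \<open>-
  2\<close>. Together with the exponents \<open>- 2/3\<close> of the kernel this gives each of the
  three linear forms the same extra exponent \<open>- 2/3\<close>, hence a power of their product.
\<close>

lemma beta_kernel_chart:
  assumes "0 < m" "m < 1" "\<bar>z\<bar> \<le> 1/4"
  shows "beta_kernel m l (reflection_chart m z) * (3 * m * (1 - m) / (1 + (2 * m - 1) * z)\<^sup>2)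
    = 3 * m * (1 - m) * beta_kernel m l m
      * exp (l * chart_exponent m z - 2/3 * ln (chart_cubic m z))"
proof -
  note b = chart_factor_bounds[OF assms] and r = reflection_chart_range[OF assms]
  define w where "w = 1 + (2 * m - 1) * z"
  have "0 < w" using b by (simp add: w_def)
  then have w2: "1 / w\<^sup>2 = exp (- 2 * ln w)"
    by (simp add: exp_minus exp_double divide_inverse)
  have c: "ln (chart_cubic m z) = ln (1 + (2 - m) * z) + ln (1 - (1 + m) * z) + ln w"
    unfolding chart_cubic_def w_def using b by (subst ln_mult; simp add: ln_mult)
  have eq: "beta_kernel m l (reflection_chart m z) * (1 / w\<^sup>2)
     = beta_kernel m l m * exp (l * chart_exponent m z - 2/3 * ln (chart_cubic m z))"
    unfolding w2 beta_kernel_eq_exp[OF r] beta_kernel_eq_exp[OF assms(1,2)] c chart_exponent_def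
      ln_reflection_chart[OF assms] w_def[symmetric] exp_add[symmetric]
    by (simp add: algebra_simps)
  have "beta_kernel m l (reflection_chart m z) * (3 * m * (1 - m) / w\<^sup>2)
    = 3 * m * (1 - m) * (beta_kernel m l (reflection_chart m z) * (1 / w\<^sup>2))"
    by simp
  then show ?thesis unfolding w_def[symmetric] eq by (simp only: mult.assoc)
qed

lemma DERIV_ln_affine:
  fixes c z :: real
  assumes "0 < 1 + c * z"
  shows "((\<lambda>z. ln (1 + c * z)) has_real_derivative c / (1 + c * z)) (at z)"
  using assms by (auto intro!: derivative_eq_intros simp: divide_inverse)

text \<open>
  The derivative is a multiple of \<open>z\<close> divided by a function without linear term,
  which expresses that the Taylor expansion of the exponent has no cubic term.
\<close>

lemma DERIV_chart_exponent:
  assumes "0 < m" "m < 1" "\<bar>z\<bar> \<le> 1/4"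
  shows "(chart_exponent m has_real_derivative - 9 * m * (1 - m) * z / chart_cubic m z) (at z)"
proof -
  note b = chart_factor_bounds[OF assms]
  define x where "x = 1 + (2 - m) * z"
  define y where "y = 1 - (1 + m) * z"
  define w where "w = 1 + (2 * m - 1) * z"
  have pos: "0 < x" "0 < y" "0 < w" using b by (simp_all add: x_def y_def w_def)
  have "((\<lambda>z. ln (1 + (2 - m) * z)) has_real_derivative (2 - m) / x) (at z)"
    "((\<lambda>z. ln (1 - (1 + m) * z)) has_real_derivative - (1 + m) / y) (at z)"
    "((\<lambda>z. ln (1 + (2 * m - 1) * z)) has_real_derivative (2 * m - 1) / w) (at z)"
    using DERIV_ln_affine[of "2 - m" z] DERIV_ln_affine[of "2 * m - 1" z] pos
      DERIV_ln_affine[of "- (1 + m)" z, unfolded mult_minus_left add_uminus_conv_diff]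
    unfolding x_def y_def w_def by blast+
  then have "(chart_exponent m has_real_derivative
      m * ((2 - m) / x) + (1 - m) * (- (1 + m) / y) - (2 * m - 1) / w) (at z)"
    unfolding chart_exponent_def[abs_def] by (intro DERIV_diff DERIV_add DERIV_cmult)
  moreover have "m * (a / x) + n * (b / y) - c / w
      = (m * a * (y * w) + n * b * (x * w) - c * (x * y)) / (x * y * w)" for a b c n :: real
    using pos by (simp add: add_divide_distrib diff_divide_distrib)
  moreover have "m * (2 - m) * (y * w) + (1 - m) * (- (1 + m)) * (x * w) - (2 * m - 1) * (x * y)
      = - 9 * m * (1 - m) * z"
    unfolding x_def y_def w_def by algebra
  moreover have "x * y * w = chart_cubic m z"
    by (simp add: chart_cubic_def x_def y_def w_def)
  ultimately show ?thesis by simp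
qed

lemma chart_exponent_0 [simp]: "chart_exponent m 0 = 0"
  by (simp add: chart_exponent_def)

text \<open>
  The product of the linear forms is at most 3, so the derivative of the exponent dominates that
  of a parabola on either side of the centre.
\<close>

lemma chart_exponent_le:
  assumes "0 < m" "m < 1" "\<bar>z\<bar> \<le> 1/4"
  shows "chart_exponent m z \<le> - (3/2) * (m * (1 - m)) * z\<^sup>2"
proof -
  define h where "h z = chart_exponent m z + (3/2) * (m * (1 - m)) * z\<^sup>2" for z
  have D: "(h has_real_derivative m * (1 - m) * z * (3 - 9 / chart_cubic m z)) (at z)"
    if "\<bar>z\<bar> \<le> 1/4" for z
    unfolding h_def using assms that chart_cubic_bounds[OF assms(1,2) that]
    by (auto intro!: derivative_eq_intros DERIV_chart_exponent simp: field_simps)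
  have nonpos: "3 - 9 / chart_cubic m z \<le> 0" if "\<bar>z\<bar> \<le> 1/4" for z
    using chart_cubic_bounds[OF assms(1,2) that] by (simp add: field_simps)
  have "h z \<le> h 0"
  proof (cases "z \<ge> 0")
    case True
    have "m * (1 - m) * x * (3 - 9 / chart_cubic m x) \<le> 0" if "0 \<le> x" "x \<le> z" for x
      using assms that True nonpos[of x]
      by (intro mult_nonneg_nonpos mult_nonneg_nonneg) auto
    then show ?thesis
      using True assms D by (intro DERIV_nonpos_imp_nonincreasing[of 0 z h]) force+
  next
    case False
    have "m * (1 - m) * x * (3 - 9 / chart_cubic m x) \<ge> 0" if "z \<le> x" "x \<le> 0" for x
      using assms that False nonpos[of x]
      by (intro mult_nonpos_nonpos[of "m * (1 - m) * x"] mult_nonneg_nonpos[of "m * (1 - m)"]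
          mult_nonneg_nonneg) auto
    then show ?thesis
      using False assms D by (intro DERIV_nonneg_imp_nondecreasing[of z 0 h]) force+
  qed
  then show ?thesis by (simp add: h_def)
qed

text \<open>
  This replaces integrals of bounds by explicit antiderivatives \<open>w\<close>.
\<close>

lemma abs_diff_le_of_DERIV_le:
  fixes v w :: "real \<Rightarrow> real"
  assumes "a \<le> b"
    and "\<And>x. a \<le> x \<Longrightarrow> x \<le> b \<Longrightarrow> (v has_real_derivative v' x) (at x)"
    and "\<And>x. a \<le> x \<Longrightarrow> x \<le> b \<Longrightarrow> (w has_real_derivative w' x) (at x)"
    and "\<And>x. a \<le> x \<Longrightarrow> x \<le> b \<Longrightarrow> \<bar>v' x\<bar> \<le> w' x"
  shows "\<bar>v b - v a\<bar> \<le> w b - w a"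
proof -
  have "w a - v a \<le> w b - v b"
    using assms(1)
  proof (rule DERIV_nonneg_imp_nondecreasing)
    fix x assume x: "a \<le> x" "x \<le> b"
    have "((\<lambda>x. w x - v x) has_real_derivative w' x - v' x) (at x)"
      using assms(2,3)[OF x] by (intro DERIV_diff)
    then show "\<exists>y. ((\<lambda>x. w x - v x) has_real_derivative y) (at x) \<and> 0 \<le> y"
      using assms(4)[OF x] by (intro exI[of _ "w' x - v' x"]) auto
  qed
  moreover have "w a + v a \<le> w b + v b"
    using assms(1)
  proof (rule DERIV_nonneg_imp_nondecreasing)
    fix x assume x: "a \<le> x" "x \<le> b"
    have "((\<lambda>x. w x + v x) has_real_derivative w' x + v' x) (at x)"
      using assms(2,3)[OF x] by (intro DERIV_add)
    then show "\<exists>y. ((\<lambda>x. w x + v x) has_real_derivative y) (at x) \<and> 0 \<le> y"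
      using assms(4)[OF x] by (intro exI[of _ "w' x + v' x"]) auto
  qed
  ultimately show ?thesis by linarith
qed

text \<open>
  In the derivative of the odd part, the difference of the reciprocal products at \<open>z\<close>
  and \<open>- z\<close> is cubic in \<open>z\<close>, and the factor \<open>z\<close> in front
  makes it of fourth order.
\<close>

lemma chart_exponent_odd_part:
  assumes m: "0 < m" "m < 1" and z: "0 \<le> z" "z \<le> 1/4"
  shows "\<bar>chart_exponent m z - chart_exponent m (- z)\<bar> \<le> 128 * z ^ 5"
proof -
  define e where "e = (2 - m) * (1 + m) * (2 * m - 1)"
  define v' where "v' x = - 18 * (m * (1 - m)) * e * x ^ 4
      / (chart_cubic m x * chart_cubic m (- x))" for x
  have D: "((\<lambda>x. chart_exponent m x - chart_exponent m (- x)) has_real_derivative v' x) (at x)"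
    if x: "0 \<le> x" "x \<le> z" for x
  proof -
    have xs: "\<bar>x\<bar> \<le> 1/4" "\<bar>- x\<bar> \<le> 1/4" using x z by auto
    note b = chart_cubic_bounds[OF m xs(1)] chart_cubic_bounds[OF m xs(2)]
    have D2: "((\<lambda>x. chart_exponent m (- x)) has_real_derivative
        (- 9 * m * (1 - m) * (- x) / chart_cubic m (- x)) * (- 1)) (at x)"
      by (rule DERIV_chain2[where g = uminus, OF DERIV_chart_exponent[OF m xs(2)]])
         (auto intro!: derivative_eq_intros)
    have "((\<lambda>x. chart_exponent m x - chart_exponent m (- x)) has_real_derivative
        - 9 * m * (1 - m) * x / chart_cubic m x
        - (- 9 * m * (1 - m) * (- x) / chart_cubic m (- x)) * (- 1)) (at x)"
      by (rule DERIV_diff[OF DERIV_chart_exponent[OF m xs(1)] D2])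
    moreover have "- 9 * m * (1 - m) * x / chart_cubic m x
        - (- 9 * m * (1 - m) * (- x) / chart_cubic m (- x)) * (- 1)
        = 9 * (m * (1 - m)) * x * (chart_cubic m x - chart_cubic m (- x))
          / (chart_cubic m x * chart_cubic m (- x))"
      using b by (simp add: field_simps)
    moreover have "\<dots> = v' x"
      unfolding chart_cubic_odd_part v'_def e_def by (simp add: eval_nat_numeral mult_ac)
    ultimately show ?thesis by simp
  qed
  have le: "\<bar>v' x\<bar> \<le> 640 * x ^ 4" if x: "0 \<le> x" "x \<le> z" for x
  proof -
    have xs: "\<bar>x\<bar> \<le> 1/4" "\<bar>- x\<bar> \<le> 1/4" using x z by auto
    note b = chart_cubic_bounds[OF m xs(1)] chart_cubic_bounds[OF m xs(2)]
    have PP: "(3/16) * (3/16) \<le> chart_cubic m x * chart_cubic m (- x)"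
      using b by (intro mult_mono) auto
    have mm: "m * (1 - m) \<le> 1/4"
      using sum_squares_ge_zero[of "m - 1/2" 0] by (simp add: field_simps)
    have num: "18 * (m * (1 - m)) * \<bar>e\<bar> * x ^ 4 \<le> 18 * (1/4) * 4 * x ^ 4"
      using chart_cubic_odd_coeff[OF m] mm x m unfolding e_def[symmetric]
      by (intro mult_mono) auto
    have "\<bar>v' x\<bar> = 18 * (m * (1 - m)) * \<bar>e\<bar> * x ^ 4 / (chart_cubic m x * chart_cubic m (- x))"
      using m b x by (simp add: v'_def abs_mult)
    also have "\<dots> \<le> 18 * (1/4) * 4 * x ^ 4 / ((3/16) * (3/16))"
      using num PP x by (intro frac_le) auto
    also have "\<dots> \<le> 640 * x ^ 4" by simp
    finally show ?thesis .
  qed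
  have "\<bar>(chart_exponent m z - chart_exponent m (- z)) - (chart_exponent m 0 - chart_exponent m (- 0))\<bar>
      \<le> 128 * z ^ 5 - 128 * 0 ^ 5"
    by (rule abs_diff_le_of_DERIV_le[OF z(1) D, where w' = "\<lambda>x. 640 * x ^ 4"])
       (auto intro!: derivative_eq_intros le)
  then show ?thesis by simp
qed

lemma ln_chart_cubic_odd_part:
  assumes m: "0 < m" "m < 1" and z: "0 \<le> z" "z \<le> 1/4"
  shows "\<bar>ln (chart_cubic m z) - ln (chart_cubic m (- z))\<bar> \<le> 48 * z ^ 3"
proof -
  have zs: "\<bar>z\<bar> \<le> 1/4" "\<bar>- z\<bar> \<le> 1/4" using z by auto
  note b = chart_cubic_bounds[OF m zs(1)] chart_cubic_bounds[OF m zs(2)]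
  have *: "ln x - ln y \<le> \<bar>x - y\<bar> * (16/3)" if "3/16 \<le> x" "3/16 \<le> y" for x y :: real
  proof -
    have "ln x - ln y \<le> (x - y) / y" using that by (intro ln_diff_le) auto
    also have "\<dots> \<le> \<bar>x - y\<bar> / y" using that by (intro divide_right_mono) auto
    also have "\<dots> \<le> \<bar>x - y\<bar> / (3/16)" using that by (intro divide_left_mono) auto
    finally show ?thesis by simp
  qed
  have "\<bar>ln (chart_cubic m z) - ln (chart_cubic m (- z))\<bar>
      \<le> \<bar>chart_cubic m z - chart_cubic m (- z)\<bar> * (16/3)"
    using *[OF b(1) b(3)] *[OF b(3) b(1)] by (simp only: abs_le_iff abs_minus_commute) simp
  also have "\<dots> = 2 * \<bar>(2 - m) * (1 + m) * (2 * m - 1)\<bar> * z ^ 3 * (16/3)"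
    unfolding chart_cubic_odd_part using z by (simp add: abs_mult)
  also have "\<dots> \<le> 2 * 4 * z ^ 3 * (16/3)"
    using chart_cubic_odd_coeff[OF m] z by (intro mult_right_mono mult_left_mono) auto
  also have "\<dots> \<le> 48 * z ^ 3" using z by simp
  finally show ?thesis .
qed

text \<open>
  The Beta kernel, with the derivative of the coordinate change, relative to its value at the
  centre.
\<close>

definition chart_density :: "real \<Rightarrow> real \<Rightarrow> real \<Rightarrow> real" where
  "chart_density m l z = exp (l * chart_exponent m z - 2/3 * ln (chart_cubic m z))"

lemma chart_density_le:
  assumes m: "0 < m" "m < 1" and z: "\<bar>z\<bar> \<le> 1/4" and l: "0 < l"
  shows "chart_density m l z \<le> 6 * exp (- (3/2) * (m * (1 - m)) * l * z\<^sup>2)"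
proof -
  note b = chart_cubic_bounds[OF m z]
  have "l * chart_exponent m z \<le> l * (- (3/2) * (m * (1 - m)) * z\<^sup>2)"
    using chart_exponent_le[OF m z] l by (intro mult_left_mono) auto
  moreover have "- ln 6 \<le> 2/3 * ln (chart_cubic m z)"
  proof -
    have "ln (1/6) \<le> ln (chart_cubic m z)" using b by (subst ln_le_cancel_iff) auto
    moreover have "0 \<le> ln (6::real)" by simp
    ultimately show ?thesis unfolding ln_div[of 1 "6::real", simplified] by linarith
  qed
  ultimately have "chart_density m l z \<le> exp (ln 6 + - (3/2) * (m * (1 - m)) * l * z\<^sup>2)"
    unfolding chart_density_def by (simp add: mult_ac)
  also have "\<dots> = 6 * exp (- (3/2) * (m * (1 - m)) * l * z\<^sup>2)"
    by (subst exp_add) simp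
  finally show ?thesis .
qed

lemma abs_exp_diff_le:
  fixes a b c :: real
  assumes "exp a \<le> c" "exp b \<le> c"
  shows "\<bar>exp a - exp b\<bar> \<le> c * \<bar>a - b\<bar>"
proof -
  have *: "exp x - exp y \<le> c * \<bar>x - y\<bar>" if "exp x \<le> c" for x y
  proof -
    have "1 - exp (y - x) \<le> \<bar>x - y\<bar>"
      using exp_ge_add_one_self[of "y - x"] by linarith
    then have "exp x * (1 - exp (y - x)) \<le> exp x * \<bar>x - y\<bar>" by (intro mult_left_mono) auto
    also have "\<dots> \<le> c * \<bar>x - y\<bar>" using that by (intro mult_right_mono) auto
    finally show ?thesis by (simp add: exp_diff right_diff_distrib)
  qed
  show ?thesis using *[OF assms(1), of b] *[OF assms(2), of a] by (simp only: abs_le_iff abs_minus_commute) simp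
qed

text \<open>
  Half of the Gaussian factor is spent on turning \<open>l * z ^ 5\<close> into a multiple of
  \<open>z ^ 3\<close>, because \<open>l * z\<^sup>2\<close> times that half is bounded.
\<close>

lemma chart_density_odd_part:
  assumes m: "0 < m" "m < 1" and z: "0 \<le> z" "z \<le> 1/4" and l: "0 < l"
  shows "\<bar>chart_density m l z - chart_density m l (- z)\<bar>
    \<le> 1200 / (m * (1 - m)) * z ^ 3 * exp (- (3/4 * (m * (1 - m)) * l) * z\<^sup>2)"
proof -
  define k where "k = m * (1 - m)"
  define u where "u = 3/4 * k * l * z\<^sup>2"
  define E where "E = exp (- u)"
  have k: "0 < k" "k \<le> 1/4"
    using m sum_squares_ge_zero[of "m - 1/2" 0] by (simp_all add: k_def field_simps)
  have E: "0 < E" "E \<le> 1" "u * E \<le> 1" "exp (- (3/2) * k * l * z\<^sup>2) = E * E"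
  proof -
    have "0 \<le> u" using k l by (simp add: u_def)
    then show "0 < E" "E \<le> 1" by (simp_all add: E_def)
    have "u \<le> exp u" using exp_ge_add_one_self[of u] by linarith
    then show "u * E \<le> 1" by (simp add: E_def exp_minus field_simps)
    show "exp (- (3/2) * k * l * z\<^sup>2) = E * E"
      unfolding E_def exp_add[symmetric] u_def by (simp add: algebra_simps)
  qed
  have zs: "\<bar>z\<bar> \<le> 1/4" "\<bar>- z\<bar> \<le> 1/4" using z by auto
  have "\<bar>chart_density m l z - chart_density m l (- z)\<bar> \<le> 6 * (E * E)
      * \<bar>(l * chart_exponent m z - 2/3 * ln (chart_cubic m z))
        - (l * chart_exponent m (- z) - 2/3 * ln (chart_cubic m (- z)))\<bar>"
    unfolding chart_density_def
    using chart_density_le[OF m zs(1) l] chart_density_le[OF m zs(2) l]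
    unfolding chart_density_def k_def[symmetric] power2_minus E(4)
    by (intro abs_exp_diff_le)
  also have "\<dots> \<le> 6 * (E * E) * (l * (128 * z ^ 5) + 2/3 * (48 * z ^ 3))"
  proof (intro mult_left_mono)
    have "l * \<bar>chart_exponent m z - chart_exponent m (- z)\<bar> \<le> l * (128 * z ^ 5)"
      using chart_exponent_odd_part[OF m z] l by (intro mult_left_mono) auto
    moreover have "l * \<bar>chart_exponent m z - chart_exponent m (- z)\<bar>
        = \<bar>l * chart_exponent m z - l * chart_exponent m (- z)\<bar>"
      using l by (simp add: abs_mult flip: right_diff_distrib)
    ultimately show "\<bar>(l * chart_exponent m z - 2/3 * ln (chart_cubic m z))
        - (l * chart_exponent m (- z) - 2/3 * ln (chart_cubic m (- z)))\<bar>
        \<le> l * (128 * z ^ 5) + 2/3 * (48 * z ^ 3)"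
      using ln_chart_cubic_odd_part[OF m z] by linarith
  qed auto
  \<comment> \<open>\<open>E * E\<close> is the full Gaussian bound; one factor \<open>E\<close> remains and the other absorbs \<open>l * z\<^sup>2\<close>.\<close>
  also have "\<dots> = z ^ 3 * E * (768 * (l * z\<^sup>2) * E + 192 * E)"
    by (simp add: algebra_simps eval_nat_numeral)
  also have "\<dots> = z ^ 3 * E * (1024 / k * (u * E) + 192 * E)"
    using k by (simp add: u_def)
  also have "\<dots> \<le> z ^ 3 * E * (1024 / k * 1 + 192 * 1)"
    using E k z by (intro mult_left_mono add_mono) auto
  also have "\<dots> \<le> z ^ 3 * E * (1200 / k)"
    using E k z by (intro mult_left_mono) (auto simp: field_simps)
  finally show ?thesis
    unfolding k_def[symmetric] E_def u_def by (simp add: mult_ac)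
qed

lemma beta_kernel_pos: "0 < t \<Longrightarrow> t < 1 \<Longrightarrow> 0 < beta_kernel m l t"
  by (simp add: beta_kernel_def)

section \<open>The approximate median of a Beta law\<close>

text \<open>
  The sum of \<open>H\<close> over the two reflected points starts at \<open>2 * H m\<close> and
  has as derivative the odd part of the density. Integrating \<open>z ^ 3\<close> against a
  Gaussian of variance of order \<open>1 / l\<close> gives \<open>1 / l\<^sup>2\<close>.
\<close>

lemma antiderivative_middle:
  assumes m: "0 < m" "m < 1" and l: "0 < l"
    and H: "\<And>t. 0 < t \<Longrightarrow> t < 1 \<Longrightarrow> (H has_real_derivative beta_kernel m l t) (at t)"
  shows "\<bar>H (reflection_chart m (1/4)) + H (reflection_chart m (- (1/4))) - 2 * H m\<bar>
    \<le> 3200 / (m * (1 - m))\<^sup>2 * (beta_kernel m l m / l\<^sup>2)"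
proof -
  define k where "k = m * (1 - m)"
  define \<mu> where "\<mu> = 3/4 * k * l"
  define A where "A = 3600 * beta_kernel m l m"
  define V where "V z = H (reflection_chart m z) + H (reflection_chart m (- z))" for z
  \<comment> \<open>An antiderivative of \<open>A * z ^ 3 * exp (- \<mu> * z\<^sup>2)\<close>.\<close>
  define W where "W z = - (A / (2 * \<mu>)) * ((z\<^sup>2 + 1 / \<mu>) * exp (- \<mu> * z\<^sup>2))" for z :: real
  have k: "0 < k" using m by (simp add: k_def)
  have mu: "0 < \<mu>" using k l by (simp add: \<mu>_def)
  have A: "0 < A" using beta_kernel_pos[OF m] by (simp add: A_def)
  have DH: "((\<lambda>z. H (reflection_chart m z)) has_real_derivative
      3 * k * beta_kernel m l m * chart_density m l z) (at z)" if z: "\<bar>z\<bar> \<le> 1/4" for z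
    using DERIV_chain2[OF H[OF reflection_chart_range[OF m z]] DERIV_reflection_chart[OF m z]]
    unfolding beta_kernel_chart[OF m z] by (simp add: k_def chart_density_def mult_ac)
  have DV: "(V has_real_derivative
      3 * k * beta_kernel m l m * (chart_density m l z - chart_density m l (- z))) (at z)"
    if z: "0 \<le> z" "z \<le> 1/4" for z
  proof -
    have zs: "\<bar>z\<bar> \<le> 1/4" "\<bar>- z\<bar> \<le> 1/4" using z by auto
    have "((\<lambda>z. H (reflection_chart m (- z))) has_real_derivative
        3 * k * beta_kernel m l m * chart_density m l (- z) * (- 1)) (at z)"
      by (rule DERIV_chain2[where g = uminus, OF DH[OF zs(2)]])
         (auto intro!: derivative_eq_intros)
    from DERIV_add[OF DH[OF zs(1)] this] show ?thesis
      unfolding V_def by (simp add: right_diff_distrib)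
  qed
  have DW: "(W has_real_derivative A * z ^ 3 * exp (- \<mu> * z\<^sup>2)) (at z)" for z
  proof -
    define e where "e = exp (- \<mu> * z\<^sup>2)"
    have "((\<lambda>z. exp (- \<mu> * z\<^sup>2)) has_real_derivative e * (- \<mu> * (2 * z))) (at z)"
      "((\<lambda>z. z\<^sup>2 + 1 / \<mu>) has_real_derivative 2 * z) (at z)"
      by (auto intro!: derivative_eq_intros simp: e_def)
    then have "(W has_real_derivative
        - (A / (2 * \<mu>)) * (2 * z * e + e * (- \<mu> * (2 * z)) * (z\<^sup>2 + 1 / \<mu>))) (at z)"
      unfolding W_def e_def by (intro DERIV_cmult DERIV_mult)
    moreover have "2 * z * e + e * (- \<mu> * (2 * z)) * (z\<^sup>2 + 1 / \<mu>) = - (2 * \<mu>) * (z ^ 3 * e)"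
      using mu by (simp add: distrib_left power2_eq_square power3_eq_cube)
    moreover have "- (A / (2 * \<mu>)) * (- (2 * \<mu>) * (z ^ 3 * e)) = A * z ^ 3 * exp (- \<mu> * z\<^sup>2)"
      using mu by (simp add: e_def)
    ultimately show ?thesis by simp
  qed
  have le: "\<bar>3 * k * beta_kernel m l m * (chart_density m l z - chart_density m l (- z))\<bar>
      \<le> A * z ^ 3 * exp (- \<mu> * z\<^sup>2)" if z: "0 \<le> z" "z \<le> 1/4" for z
  proof -
    have "\<bar>3 * k * beta_kernel m l m * (chart_density m l z - chart_density m l (- z))\<bar>
        = 3 * k * beta_kernel m l m * \<bar>chart_density m l z - chart_density m l (- z)\<bar>"
      using k beta_kernel_pos[OF m, of m l] by (simp add: abs_mult)
    also have "\<dots> \<le> 3 * k * beta_kernel m l m * (1200 / k * z ^ 3 * exp (- \<mu> * z\<^sup>2))"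
      using chart_density_odd_part[OF m z l] k beta_kernel_pos[OF m, of m l]
      unfolding k_def[symmetric] \<mu>_def[symmetric] by (intro mult_left_mono) auto
    also have "\<dots> = A * z ^ 3 * exp (- \<mu> * z\<^sup>2)" using k by (simp add: A_def)
    finally show ?thesis .
  qed
  have "\<bar>V (1/4) - V 0\<bar> \<le> W (1/4) - W 0"
    by (rule abs_diff_le_of_DERIV_le[OF _ DV DW le]) auto
  also have "\<dots> \<le> - W 0"
    using A mu by (simp add: W_def)
  also have "\<dots> = 3200 / k\<^sup>2 * (beta_kernel m l m / l\<^sup>2)"
    using k l by (simp add: W_def A_def \<mu>_def power2_eq_square)
  finally show ?thesis by (simp add: V_def k_def)
qed

lemma DERIV_beta_exponent:
  assumes "0 < t" "t < 1"
  shows "(beta_exponent m has_real_derivative (m - t) / (t * (1 - t))) (at t)"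
proof -
  have "((\<lambda>t. ln (1 - t)) has_real_derivative - 1 / (1 - t)) (at t)"
    using assms by (auto intro!: derivative_eq_intros simp: divide_inverse)
  then have "(beta_exponent m has_real_derivative m * (1 / t) + (1 - m) * (- 1 / (1 - t))) (at t)"
    unfolding beta_exponent_def[abs_def] using assms
    by (intro DERIV_add DERIV_cmult DERIV_ln_divide)
  moreover have "m * (1 / t) + (1 - m) * (- 1 / (1 - t)) = (m - t) / (t * (1 - t))"
    using assms by (simp add: field_simps)
  ultimately show ?thesis by simp
qed

lemma beta_exponent_tail:
  assumes m: "0 < m" "m < 1" and t: "0 < t" "t < 1"
    and out: "t \<le> reflection_chart m (- (1/4)) \<or> reflection_chart m (1/4) \<le> t"
  shows "beta_exponent m t - beta_exponent m m \<le> - (3/32) * (m * (1 - m))"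
proof -
  have end_le: "beta_exponent m (reflection_chart m z) - beta_exponent m m \<le> - (3/32) * (m * (1 - m))"
    if "\<bar>z\<bar> = 1/4" for z
  proof -
    have z2: "z\<^sup>2 = 1/16" using arg_cong[OF that, of "\<lambda>x. x\<^sup>2"] by (simp add: power_divide)
    show ?thesis
      using chart_exponent_le[OF m, of z, unfolded z2] beta_exponent_chart[OF m, of z] that by simp
  qed
  from out show ?thesis
  proof
    let ?s = "reflection_chart m (- (1/4))"
    assume le: "t \<le> ?s"
    have "?s - m \<le> 0"
      using m chart_factor_bounds[OF m, of "- (1/4)"]
      by (subst reflection_chart_minus_center) (auto intro!: divide_nonpos_pos mult_nonneg_nonneg)
    moreover have "?s < 1" using reflection_chart_range[OF m, of "- (1/4)"] by simp
    ultimately have "beta_exponent m t \<le> beta_exponent m ?s"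
      using t by (intro DERIV_nonneg_imp_nondecreasing[OF le])
        (auto intro!: exI DERIV_beta_exponent divide_nonneg_pos)
    then show ?thesis using end_le[of "- (1/4)"] by simp
  next
    let ?s = "reflection_chart m (1/4)"
    assume le: "?s \<le> t"
    have "?s - m \<ge> 0"
      using m chart_factor_bounds[OF m, of "1/4"]
      by (subst reflection_chart_minus_center) (auto intro!: divide_nonneg_pos mult_nonneg_nonneg)
    moreover have "0 < ?s" using reflection_chart_range[OF m, of "1/4"] by simp
    ultimately have "beta_exponent m t \<le> beta_exponent m ?s"
      using t by (intro DERIV_nonpos_imp_nonincreasing[OF le])
        (auto intro!: exI DERIV_beta_exponent divide_nonpos_pos)
    then show ?thesis using end_le[of "1/4"] by simp
  qed
qed

lemma exp_minus_le_inverse_square: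
  fixes x :: real
  assumes "0 < x"
  shows "exp (- x) \<le> 2 / x\<^sup>2"
proof -
  have "x\<^sup>2 / 2 \<le> exp x"
    using exp_lower_Taylor_quadratic[of x] assms by simp
  then show ?thesis using assms by (simp add: exp_minus field_simps)
qed

text \<open>
  The shift of the exponents by \<open>- 2/3\<close> can keep the kernel from being monotone on
  both sides of \<open>m\<close>. A fixed part \<open>l0 = 1 / k\<close> of \<open>l\<close> is
  therefore set aside to keep the exponents of the remaining factor nonnegative, so that this
  factor is at most 1. The rest, of size at least \<open>l / 2\<close>, decays exponentially by
  \<open>beta_exponent_tail\<close>.
\<close>

lemma beta_kernel_tail:
  assumes m: "0 < m" "m < 1" and k: "0 < k" "k \<le> m * (1 - m)" and l: "2 / k \<le> l"
    and t: "0 < t" "t < 1"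
    and out: "t \<le> reflection_chart m (- (1/4)) \<or> reflection_chart m (1/4) \<le> t"
  shows "beta_kernel m l t \<le> 1024 / (k\<^sup>2 * (k powr (1/k))\<^sup>2) * (beta_kernel m l m / l\<^sup>2)"
proof -
  define l0 where "l0 = 1 / k"
  have mk: "k \<le> m" "k \<le> 1 - m"
    by (rule order_trans[OF k(2)], use m in \<open>simp add: mult_left_le mult_left_le_one_le\<close>)+
  have exps: "2/3 \<le> l0 * m" "l0 * m \<le> l0" "2/3 \<le> l0 * (1 - m)" "l0 * (1 - m) \<le> l0"
    using k mk m by (auto simp: l0_def field_simps)
  have split: "beta_kernel m l s = exp ((l - l0) * beta_exponent m s)
      * (s powr (l0 * m - 2/3) * (1 - s) powr (l0 * (1 - m) - 2/3))" if "0 < s" "s < 1" for s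
  proof -
    have "beta_kernel m l s = exp ((l - l0) * beta_exponent m s
        + ((l0 * m - 2/3) * ln s + (l0 * (1 - m) - 2/3) * ln (1 - s)))"
      unfolding beta_kernel_eq_exp[OF that] beta_exponent_def by (simp add: algebra_simps)
    then show ?thesis using that by (simp add: powr_def exp_add)
  qed
  have l': "l / 2 \<le> l - l0" "0 < l"
  proof -
    have "0 < l0" "2 * l0 \<le> l" using l k by (simp_all add: l0_def)
    then show "l / 2 \<le> l - l0" "0 < l" by linarith+
  qed
  have low: "k powr l0 \<le> x powr (l0 * y - 2/3)"
    if "k \<le> x" "x < 1" "2/3 \<le> l0 * y" "l0 * y \<le> l0" for x y
  proof -
    have "k powr l0 \<le> x powr l0" using that k by (intro powr_mono2) (auto simp: l0_def)
    also have "\<dots> \<le> x powr (l0 * y - 2/3)" using that k by (intro powr_mono') auto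
    finally show ?thesis .
  qed
  have center: "exp ((l - l0) * beta_exponent m m) * (k powr l0)\<^sup>2 \<le> beta_kernel m l m"
    unfolding split[OF m] power2_eq_square
    using low[of m m] low[of "1 - m" "1 - m"] exps mk m by (intro mult_left_mono mult_mono) auto
  have "beta_kernel m l t \<le> exp ((l - l0) * beta_exponent m t) * (1 * 1)"
    unfolding split[OF t] using t exps
    by (intro mult_left_mono mult_mono powr_le1) auto
  also have "\<dots> = exp ((l - l0) * beta_exponent m m)
      * exp ((l - l0) * (beta_exponent m t - beta_exponent m m))"
    by (simp add: right_diff_distrib exp_diff)
  also have "\<dots> \<le> (beta_kernel m l m / (k powr l0)\<^sup>2) * exp (- (3/64 * k * l))"
  proof (intro mult_mono)
    show "exp ((l - l0) * beta_exponent m m) \<le> beta_kernel m l m / (k powr l0)\<^sup>2"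
      using center k by (simp add: field_simps)
    have "(l - l0) * (beta_exponent m t - beta_exponent m m) \<le> (l - l0) * (- (3/32) * k)"
      using beta_exponent_tail[OF m t out] k l' by (intro mult_left_mono) auto
    also have "\<dots> \<le> (l / 2) * (- (3/32) * k)"
      using l' k by (intro mult_right_mono_neg) auto
    finally show "exp ((l - l0) * (beta_exponent m t - beta_exponent m m)) \<le> exp (- (3/64 * k * l))"
      by (simp add: mult_ac)
  qed (use beta_kernel_pos[OF m, of m l] in auto)
  also have "\<dots> \<le> (beta_kernel m l m / (k powr l0)\<^sup>2) * (2 / (3/64 * k * l)\<^sup>2)"
    using exp_minus_le_inverse_square[of "3/64 * k * l"] k l' beta_kernel_pos[OF m, of m l]
    by (intro mult_left_mono) auto
  also have "\<dots> = 8192 / 9 * (1 / (k\<^sup>2 * (k powr l0)\<^sup>2) * (beta_kernel m l m / l\<^sup>2))"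
    by (simp add: power_mult_distrib power_divide mult_ac)
  also have "\<dots> \<le> 1024 * (1 / (k\<^sup>2 * (k powr l0)\<^sup>2) * (beta_kernel m l m / l\<^sup>2))"
    using beta_kernel_pos[OF m, of m l] by (intro mult_right_mono) auto
  finally show ?thesis by (simp add: l0_def)
qed

text \<open>
  Here \<open>H\<close> is any antiderivative of the kernel, so the left-hand side is the
  difference between its integrals over the two sides of \<open>m\<close>. The middle part cancels
  by reflection, and each tail is bounded by the supremum of the kernel there, the interval having
  length at most 1.
\<close>

lemma beta_median:
  fixes k :: real
  assumes k: "0 < k"
  obtains C where "0 < C"
    "\<And>m l H. \<lbrakk>0 < m; m < 1; k \<le> m * (1 - m); 2 / k \<le> l; continuous_on {0..1} H;
        \<And>t. 0 < t \<Longrightarrow> t < 1 \<Longrightarrow> (H has_real_derivative beta_kernel m l t) (at t)\<rbrakk>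
      \<Longrightarrow> \<bar>H 0 + H 1 - 2 * H m\<bar> \<le> C * (beta_kernel m l m / l\<^sup>2)"
proof
  define D where "D = 1024 / (k\<^sup>2 * (k powr (1/k))\<^sup>2)"
  have D: "0 < D" using k by (simp add: D_def)
  show "0 < 3200 / k\<^sup>2 + 2 * D" using D k by (simp add: add_pos_pos)
  fix m l H
  assume m: "0 < m" "m < 1" and km: "k \<le> m * (1 - m)" and l: "2 / k \<le> l"
    and cont: "continuous_on {0..1} H"
    and H: "\<And>t. 0 < t \<Longrightarrow> t < 1 \<Longrightarrow> (H has_real_derivative beta_kernel m l t) (at t)"
  let ?B = "beta_kernel m l m / l\<^sup>2"
  let ?a = "reflection_chart m (- (1/4))" and ?b = "reflection_chart m (1/4)"
  have lpos: "0 < l" using l k by (smt (verit) divide_pos_pos)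
  have B: "0 < ?B" using beta_kernel_pos[OF m] lpos by simp
  have incr: "\<bar>H y - H x\<bar> \<le> D * ?B"
    if xy: "0 \<le> x" "x < y" "y \<le> 1"
      and out: "\<And>t. x < t \<Longrightarrow> t < y \<Longrightarrow> t \<le> ?a \<or> ?b \<le> t" for x y
  proof -
    have "\<exists>d t. x < t \<and> t < y \<and> (H has_real_derivative d) (at t) \<and> H y - H x = (y - x) * d"
    proof (rule MVT[OF xy(2)])
      show "continuous_on {x..y} H" using cont by (rule continuous_on_subset) (use xy in auto)
      show "H differentiable at t" if "x < t" "t < y" for t
        using H[of t] that xy by (auto simp: real_differentiable_def)
    qed
    then obtain t d where t: "x < t" "t < y" "(H has_real_derivative d) (at t)"
      "H y - H x = (y - x) * d" by blast
    have t01: "0 < t" "t < 1" using t xy by auto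
    have d: "d = beta_kernel m l t" using DERIV_unique[OF t(3) H[OF t01]] .
    have "\<bar>H y - H x\<bar> = (y - x) * beta_kernel m l t"
      using t(4) xy beta_kernel_pos[OF t01, of m l] by (simp add: d abs_mult)
    also have "\<dots> \<le> 1 * (D * ?B)"
      using beta_kernel_tail[OF m k km l t01 out[OF t(1,2)]] xy beta_kernel_pos[OF t01, of m l]
      unfolding D_def by (intro mult_mono) auto
    finally show ?thesis by simp
  qed
  have "\<bar>H ?a - H 0\<bar> \<le> D * ?B"
    by (rule incr) (use reflection_chart_range[OF m, of "- (1/4)"] in auto)
  moreover have "\<bar>H 1 - H ?b\<bar> \<le> D * ?B"
    by (rule incr) (use reflection_chart_range[OF m, of "1/4"] in auto)
  moreover have "\<bar>H ?b + H ?a - 2 * H m\<bar> \<le> 3200 / k\<^sup>2 * ?B"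
  proof -
    have "3200 / (m * (1 - m))\<^sup>2 * ?B \<le> 3200 / k\<^sup>2 * ?B"
      using km k B by (intro mult_right_mono divide_left_mono power_mono mult_pos_pos) auto
    then show ?thesis using antiderivative_middle[OF m lpos H] by linarith
  qed
  ultimately have "\<bar>H 0 + H 1 - 2 * H m\<bar> \<le> 3200 / k\<^sup>2 * ?B + D * ?B + D * ?B"
    by linarith
  then show "\<bar>H 0 + H 1 - 2 * H m\<bar> \<le> (3200 / k\<^sup>2 + 2 * D) * ?B"
    by (simp only: distrib_right mult_2 add.assoc)
qed

section \<open>The Beta kernel near its centre\<close>

lemma variance_ge_between:
  fixes a b t k :: real
  assumes "a \<le> t" "t \<le> b" "k \<le> a * (1 - a)" "k \<le> b * (1 - b)"
  shows "k \<le> t * (1 - t)"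
proof -
  have "0 \<le> (t - a) * (b - t)" using assms by simp
  then have ge: "t * (1 - a - b) + a * b \<le> t * (1 - t)" by (simp add: algebra_simps)
  show ?thesis
  proof (cases "0 \<le> 1 - a - b")
    case True
    then have "a * (1 - a - b) \<le> t * (1 - a - b)" using assms by (intro mult_right_mono) auto
    then show ?thesis using ge assms by (simp add: algebra_simps)
  next
    case False
    then have "b * (1 - a - b) \<le> t * (1 - a - b)" using assms by (intro mult_right_mono_neg) auto
    then show ?thesis using ge assms by (simp add: algebra_simps)
  qed
qed

text \<open>
  The logarithmic derivative of the kernel at \<open>t\<close> has the numerator \<open>l * (m -
  t) + (4 * t - 2) / 3\<close>, which stays bounded between \<open>p\<close> and \<open>m\<close>
  because these points are only \<open>b / l\<close> apart. Over such a short interval the kernel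
  is constant up to a factor \<open>1 + O(1 / l)\<close>.
\<close>

lemma beta_kernel_ratio:
  assumes m: "0 < m" "m < 1" and p: "0 < p" "p < 1" and s: "s \<in> closed_segment p m"
    and k: "0 < k" "k \<le> m * (1 - m)" "k \<le> p * (1 - p)" and l: "0 < l"
    and b: "l * \<bar>m - p\<bar> \<le> b" "b * (b + 1) / (k * l) \<le> 1/2"
  shows "\<bar>beta_kernel m l s / beta_kernel m l p - 1\<bar> \<le> 2 * (b * (b + 1) / (k * l))"
proof -
  define G where "G t = (l * m - 2/3) * ln t + (l * (1 - m) - 2/3) * ln (1 - t)" for t
  define G' where "G' t = (l * (m - t) + (4 * t - 2) / 3) / (t * (1 - t))" for t
  have b0: "0 \<le> b" using b(1) l by (smt (verit) abs_ge_zero mult_nonneg_nonneg)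
  have seg: "0 < t" "t < 1" "\<bar>m - t\<bar> \<le> \<bar>m - p\<bar>" "\<bar>t - p\<bar> \<le> \<bar>m - p\<bar>" "k \<le> t * (1 - t)"
    if "t \<in> closed_segment p m" for t
    using that m p k variance_ge_between[of p t m k] variance_ge_between[of m t p k]
    by (auto simp: closed_segment_eq_real_ivl split: if_splits)
  have D: "(G has_real_derivative G' t) (at t within closed_segment p m)"
    if t: "t \<in> closed_segment p m" for t
  proof -
    have "((\<lambda>t. ln (1 - t)) has_real_derivative - 1 / (1 - t)) (at t)"
      using seg[OF t] by (auto intro!: derivative_eq_intros simp: divide_inverse)
    then have "(G has_real_derivative
        (l * m - 2/3) * (1 / t) + (l * (1 - m) - 2/3) * (- 1 / (1 - t))) (at t)"
      unfolding G_def using seg[OF t] by (intro DERIV_add DERIV_cmult DERIV_ln_divide)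
    moreover have "(l * m - 2/3) * (1 / t) + (l * (1 - m) - 2/3) * (- 1 / (1 - t)) = G' t"
      unfolding G'_def using seg[OF t] by (simp add: field_simps)
    ultimately show ?thesis by (simp add: has_field_derivative_at_within)
  qed
  have G': "norm (G' t) \<le> (b + 1) / k" if t: "t \<in> closed_segment p m" for t
  proof -
    note st = seg[OF t]
    have "l * \<bar>m - t\<bar> \<le> b" using st(3) l b(1) by (smt (verit) mult_left_mono)
    then have "\<bar>l * (m - t)\<bar> \<le> b" using l by (simp add: abs_mult)
    moreover have "\<bar>(4 * t - 2) / 3\<bar> \<le> 1" using st(1,2) by (simp add: abs_le_iff)
    ultimately have "\<bar>l * (m - t) + (4 * t - 2) / 3\<bar> \<le> b + 1"
      by (intro order_trans[OF abs_triangle_ineq] add_mono)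
    then have "\<bar>l * (m - t) + (4 * t - 2) / 3\<bar> / (t * (1 - t)) \<le> (b + 1) / k"
      using st k b0 by (intro frac_le) auto
    then show ?thesis using st by (simp add: G'_def abs_mult)
  qed
  have "norm (G s - G p) \<le> (b + 1) / k * norm (s - p)"
    by (rule field_differentiable_bound[OF convex_closed_segment D G' s]) auto
  also have "\<dots> \<le> (b + 1) / k * (b / l)"
  proof (rule mult_left_mono)
    have "\<bar>s - p\<bar> \<le> \<bar>m - p\<bar>" using seg[OF s] by simp
    also have "\<dots> \<le> b / l" using b l by (simp add: field_simps)
    finally show "norm (s - p) \<le> b / l" by simp
  qed (use b0 k in auto)
  also have "\<dots> = b * (b + 1) / (k * l)" by simp
  finally have G: "\<bar>G s - G p\<bar> \<le> b * (b + 1) / (k * l)" by simp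
  have eq: "beta_kernel m l s / beta_kernel m l p = exp (G s - G p)"
    using beta_kernel_eq_exp[OF seg(1,2)[OF s], of m l] beta_kernel_eq_exp[OF p, of m l]
    by (simp add: G_def exp_diff)
  have "exp (G s - G p) \<le> 2"
    using exp_bound_half[of "G s - G p"] G b(2) by simp
  then have "\<bar>exp (G s - G p) - exp 0\<bar> \<le> 2 * \<bar>(G s - G p) - 0\<bar>"
    by (intro abs_exp_diff_le) auto
  then show ?thesis unfolding eq using G by simp
qed

section \<open>Lower tails of the negative binomial law as functions of the parameter\<close>

definition negbin_coeff :: "real \<Rightarrow> nat \<Rightarrow> real" where
  "negbin_coeff r n = Gamma (r + real n) / (Gamma r * fact n)"

lemma negbin_coeff_pos: "0 < r \<Longrightarrow> 0 < negbin_coeff r n"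
  by (simp add: negbin_coeff_def Gamma_real_pos)

text \<open>
  This recurrence makes the sum in \<open>DERIV_negbin_below\<close> telescope.
\<close>

lemma negbin_coeff_Suc:
  assumes "0 < r"
  shows "real (Suc n) * negbin_coeff r (Suc n) = (r + real n) * negbin_coeff r n"
proof -
  have "r + real n \<notin> \<int>\<^sub>\<le>\<^sub>0" using assms nonpos_Ints_nonpos[of "r + real n"] by auto
  then have "Gamma (r + real (Suc n)) = (r + real n) * Gamma (r + real n)"
    using Gamma_plus1[of "r + real n"] by (simp add: add_ac)
  then show ?thesis
    unfolding negbin_coeff_def fact_Suc by (simp del: of_nat_Suc)
qed

lemma negbin_mass_eq_coeff: "negbin_mass r t n = negbin_coeff r n * ((1 - t) powr r * t ^ n)"
  by (simp add: negbin_mass_def negbin_coeff_def)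

definition negbin_below :: "real \<Rightarrow> nat \<Rightarrow> real \<Rightarrow> real" where
  "negbin_below r n t = (\<Sum>k<n. negbin_mass r t k)"

lemma DERIV_negbin_below:
  assumes r: "0 < r" and t: "t < 1"
  shows "(negbin_below r n has_real_derivative
    - (real n * negbin_coeff r n * ((1 - t) powr (r - 1) * t ^ (n - 1)))) (at t)"
proof (induction n)
  case 0
  show ?case by (simp add: negbin_below_def[abs_def])
next
  case (Suc n)
  have pw: "(1 - t) powr r = (1 - t) powr (r - 1) * (1 - t)"
    using t powr_mult_base[of "1 - t" "r - 1"] by (simp add: mult.commute)
  have tn: "real n * t ^ (n - 1) * t = real n * t ^ n"
    by (cases n) auto
  have "((\<lambda>t. (1 - t) powr r * t ^ n) has_real_derivative
      - r * (1 - t) powr (r - 1) * t ^ n + real n * t ^ (n - 1) * (1 - t) powr r) (at t)"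
    using t by (auto intro!: derivative_eq_intros)
  then have "((\<lambda>t. negbin_below r n t + negbin_mass r t n) has_real_derivative
      - (real n * negbin_coeff r n * ((1 - t) powr (r - 1) * t ^ (n - 1)))
      + negbin_coeff r n *
        (- r * (1 - t) powr (r - 1) * t ^ n + real n * t ^ (n - 1) * (1 - t) powr r)) (at t)"
    unfolding negbin_mass_eq_coeff by (intro DERIV_add Suc.IH DERIV_cmult)
  also have "- (real n * negbin_coeff r n * ((1 - t) powr (r - 1) * t ^ (n - 1)))
      + negbin_coeff r n *
        (- r * (1 - t) powr (r - 1) * t ^ n + real n * t ^ (n - 1) * (1 - t) powr r)
      = - (negbin_coeff r n * (1 - t) powr (r - 1) * (r * t ^ n + real n * t ^ (n - 1) * t))"
    unfolding pw by (simp add: algebra_simps)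
  also have "\<dots> = - ((r + real n) * negbin_coeff r n * ((1 - t) powr (r - 1) * t ^ n))"
    unfolding tn by (simp add: algebra_simps)
  also have "\<dots> = - (real (Suc n) * negbin_coeff r (Suc n) * ((1 - t) powr (r - 1) * t ^ (Suc n - 1)))"
    unfolding negbin_coeff_Suc[OF r] by simp
  also have "(\<lambda>t. negbin_below r n t + negbin_mass r t n) = negbin_below r (Suc n)"
    by (simp add: negbin_below_def fun_eq_iff)
  finally show ?case .
qed

lemma continuous_on_negbin_below:
  assumes "0 < r"
  shows "continuous_on {0..1} (negbin_below r n)"
  unfolding negbin_below_def[abs_def] negbin_mass_eq_coeff
  using assms by (intro continuous_intros continuous_on_powr') auto

lemma negbin_below_0:
  assumes "0 < r" "0 < n"
  shows "negbin_below r n 0 = 1"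
proof -
  have "negbin_below r n 0 = (\<Sum>k\<in>{0}. negbin_mass r 0 k)"
    unfolding negbin_below_def using assms
    by (intro sum.mono_neutral_right) (auto simp: negbin_mass_def)
  then show ?thesis using assms by (simp add: negbin_mass_def Gamma_real_pos less_imp_neq[symmetric])
qed

lemma negbin_below_1: "negbin_below r n 1 = 0"
  by (simp add: negbin_below_def negbin_mass_def)

text \<open>
  The choice of \<open>l\<close> and \<open>m\<close> for which the derivative of
  \<open>negbin_below\<close> becomes the kernel of the previous sections: \<open>l * m = n -
  1/3\<close> and \<open>l * (1 - m) = r - 1/3\<close>.
\<close>

lemma beta_kernel_negbin:
  assumes "0 < n" "0 < r" "l = r + real n - 2/3" "0 < l" "m = (real n - 1/3) / l" "0 < t" "t < 1"
  shows "beta_kernel m l t = (1 - t) powr (r - 1) * t ^ (n - 1)"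
proof -
  have "l * m = real n - 1/3" using assms(4,5) by simp
  moreover have "l * (1 - m) = l - l * m" by (simp add: algebra_simps)
  ultimately have "l * m - 2/3 = real (n - 1)" "l * (1 - m) - 2/3 = r - 1"
    using assms by (simp_all add: of_nat_diff)
  then have "beta_kernel m l t = t powr real (n - 1) * (1 - t) powr (r - 1)"
    unfolding beta_kernel_def by simp
  then show ?thesis using \<open>0 < t\<close> by (simp add: powr_realpow del: of_nat_diff)
qed

section \<open>Expansion of the lower tail near the mean\<close>

text \<open>
  Three errors add up, each of relative size \<open>1 / r\<close> with respect to the point mass:
  the deviation of the tail from \<open>1/2\<close> at the parameter \<open>m\<close>
  (\<open>E1\<close>), the deviation from linearity between \<open>m\<close> and \<open>p\<close>
  (\<open>E2\<close>), and the replacement of the slope by the point mass (\<open>E3\<close>).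
\<close>

lemma negbin_below_expansion:
  fixes p B :: real
  assumes p: "0 < p" "p < 1" and B: "0 \<le> B"
  obtains C R where "0 < C" "0 < R"
    "\<And>r n. R \<le> r \<Longrightarrow> \<bar>real n - (r * p / (1 - p) + (1/2 - (1 + p) / (6 * (1 - p))))\<bar> \<le> B \<Longrightarrow>
      \<bar>negbin_below r n p - 1/2
        - negbin_mass r p n * (real n - (r * p / (1 - p) + (1/2 - (1 + p) / (6 * (1 - p)))))\<bar>
      \<le> C / r * negbin_mass r p n"
proof -
  define q where "q = 1 - p"
  define c where "c = 1/2 - (1 + p) / (6 * q)"
  define k where "k = p * q / 4"
  have q: "0 < q" "p + q = 1" and k: "0 < k" using p by (simp_all add: q_def k_def)
  obtain C0 where C0: "0 < C0" and med:
    "\<And>m l H. \<lbrakk>0 < m; m < 1; k \<le> m * (1 - m); 2 / k \<le> l; continuous_on {0..1} H;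
        \<And>t. 0 < t \<Longrightarrow> t < 1 \<Longrightarrow> (H has_real_derivative beta_kernel m l t) (at t)\<rbrakk>
      \<Longrightarrow> \<bar>H 0 + H 1 - 2 * H m\<bar> \<le> C0 * (beta_kernel m l m / l\<^sup>2)"
    using beta_median[OF k] by blast
  define b where "b = B * (B + 1)"
  define C where "C = C0 / (p * q) + 2 * b * B / (k * (p * q)) + b / p"
  \<comment> \<open>The entries ensure, in this order: \<open>l \<ge> r / 2\<close> and \<open>l \<ge> n\<close>; \<open>n > 0\<close>; \<open>\<bar>m - p\<bar> \<le> p / 2\<close>;
    \<open>\<bar>m - p\<bar> \<le> q / 2\<close>; \<open>l \<ge> 2 / k\<close>; \<open>b / (k * l) \<le> 1/2\<close>.\<close>
  define R where "R = max 2 (max ((B + \<bar>c\<bar> + 1) / p) (max (4 * B / p) (max (4 * B / q)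
     (max (4 / k) (4 * b / k)))))"
  have b0: "0 \<le> b" using B by (simp add: b_def)
  have C: "0 < C" using C0 p q k B b0 by (simp add: C_def add_pos_nonneg)
  have main: "\<bar>negbin_below r n p - 1/2 - negbin_mass r p n * (real n - (r * p / q + c))\<bar>
      \<le> 2 * C / r * negbin_mass r p n"
    if r: "R \<le> r" and near: "\<bar>real n - (r * p / q + c)\<bar> \<le> B" for r n
  proof -
    define \<delta> where "\<delta> = real n - (r * p / q + c)"
    define l where "l = r + real n - 2/3"
    define m where "m = (real n - 1/3) / l"
    define M where "M = negbin_mass r p n"
    define f where "f = beta_kernel m l"
    define D where "D = real n * negbin_coeff r n"
    have r2: "2 \<le> r" and rs: "(B + \<bar>c\<bar> + 1) / p \<le> r" "4 * B / p \<le> r" "4 * B / q \<le> r" "4 / k \<le> r"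
        "4 * b / k \<le> r"
      using r by (simp_all add: R_def)
    have l: "r / 2 \<le> l" "0 < l" "real n \<le> l" using r2 by (simp_all add: l_def)
    have n: "0 < n"
    proof -
      have "B + \<bar>c\<bar> + 1 \<le> r * p" using rs(1) p by (simp add: field_simps)
      also have "\<dots> \<le> r * p / q" using p q r2 by (simp add: field_simps)
      finally have "0 < real n" using near by linarith
      then show ?thesis by simp
    qed
    \<comment> \<open>This identity is where the constant \<open>c\<close> comes from.\<close>
    have mp: "l * (m - p) = q * \<delta>"
    proof -
      have "l * m = real n - 1/3" using l by (simp add: m_def)
      then have "l * (m - p) = real n - 1/3 - p * l" by (simp add: right_diff_distrib mult.commute)
      also have "\<dots> = q * real n - (r * p + (q / 2 - (1 + p) / 6))"
        by (simp add: l_def q_def algebra_simps) (simp add: field_simps)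
      also have "q / 2 - (1 + p) / 6 = q * c"
        using q by (simp add: c_def right_diff_distrib)
      also have "q * real n - (r * p + q * c) = q * \<delta>"
        using q by (simp add: \<delta>_def right_diff_distrib distrib_left)
      finally show ?thesis .
    qed
    have lmp: "l * \<bar>m - p\<bar> \<le> B"
    proof -
      have "l * \<bar>m - p\<bar> = q * \<bar>\<delta>\<bar>" using arg_cong[OF mp, of abs] l q by (simp add: abs_mult)
      also have "\<dots> \<le> 1 * B" using near q p unfolding \<delta>_def by (intro mult_mono) auto
      finally show ?thesis by simp
    qed
    have mp_le: "\<bar>m - p\<bar> \<le> B / l" using lmp l by (simp add: field_simps)
    have "B / l \<le> B / (r / 2)" using B l r2 by (intro divide_left_mono) auto
    moreover have "B / (r / 2) \<le> p / 2" "B / (r / 2) \<le> q / 2"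
      using rs r2 p q by (simp_all add: field_simps)
    ultimately have "\<bar>m - p\<bar> \<le> p / 2" "\<bar>m - p\<bar> \<le> q / 2"
      using mp_le by linarith+
    then have m_bds: "p / 2 \<le> m" "q / 2 \<le> 1 - m"
      using q by linarith+
    then have m: "0 < m" "m < 1" using p q by linarith+
    have km: "k \<le> m * (1 - m)"
      using mult_mono[OF m_bds] p q m by (simp add: k_def)
    have kp: "k \<le> p * (1 - p)" using p q by (simp add: k_def q_def[symmetric])
    have l2k: "2 / k \<le> l" using rs(4) l(1) by linarith
    have eps: "b / (k * l) \<le> 1/2"
    proof -
      have "b / k \<le> l / 2" using rs(5) l(1) by linarith
      then show ?thesis using k l by (simp add: field_simps)
    qed
    have f: "f t = (1 - t) powr (r - 1) * t ^ (n - 1)" if "0 < t" "t < 1" for t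
      unfolding f_def using n r2 l that
      by (intro beta_kernel_negbin) (auto simp: l_def m_def)
    have fpos: "0 < f t" if "0 < t" "t < 1" for t
      unfolding f_def using that by (rule beta_kernel_pos)
    have D: "0 < D" using n r2 by (simp add: D_def negbin_coeff_pos)
    have DT: "(negbin_below r n has_real_derivative - (D * f t)) (at t)" if "0 < t" "t < 1" for t
      using DERIV_negbin_below[of r t n] that r2 by (simp add: D_def f)
    \<comment> \<open>The derivative at \<open>p\<close> in units of the point mass \<open>M\<close>.\<close>
    have Dfp: "D * f p = M * real n / (p * q)"
    proof -
      have "(1 - p) powr r = (1 - p) powr (r - 1) * q"
        using p powr_mult_base[of "1 - p" "r - 1"] by (simp add: mult.commute q_def)
      moreover have "p ^ n = p ^ (n - 1) * p" using n by (cases n) auto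
      ultimately have "M = negbin_coeff r n * f p * (p * q)"
        using p by (simp add: M_def negbin_mass_eq_coeff f mult_ac)
      then show ?thesis using p q by (simp add: D_def mult_ac)
    qed
    have M: "0 < M" using p r2 by (simp add: M_def negbin_mass_eq_coeff negbin_coeff_pos)
    have Dfpl: "D * f p / l \<le> M / (p * q)"
    proof -
      have "D * f p / l = M / (p * q) * (real n / l)" by (simp add: Dfp)
      also have "\<dots> \<le> M / (p * q) * 1" using M p q l by (intro mult_left_mono) auto
      finally show ?thesis by simp
    qed
    have ratio: "\<bar>f t - f p\<bar> \<le> f p * (2 * (b / (k * l)))" if t: "t \<in> closed_segment p m" for t
    proof -
      have "\<bar>f t / f p - 1\<bar> \<le> 2 * (b / (k * l))"
        unfolding f_def b_def
        by (rule beta_kernel_ratio[OF m p t k km kp l(2) lmp eps[unfolded b_def]])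
      moreover have "\<bar>f t - f p\<bar> = f p * \<bar>f t / f p - 1\<bar>"
      proof -
        have "f t - f p = f p * (f t / f p - 1)" using fpos[OF p] by (simp add: right_diff_distrib)
        then show ?thesis using fpos[OF p] by (simp only: abs_mult abs_of_pos)
      qed
      ultimately show ?thesis using fpos[OF p] by (simp only: mult_left_mono less_imp_le)
    qed
    have fm: "f m \<le> 2 * f p"
    proof -
      have "2 * (b / (k * l)) \<le> 1" using eps by linarith
      then have "f p * (2 * (b / (k * l))) \<le> f p * 1"
        by (rule mult_left_mono[OF _ less_imp_le[OF fpos[OF p]]])
      moreover have "\<bar>f m - f p\<bar> \<le> f p * (2 * (b / (k * l)))"
        by (intro ratio ends_in_segment)
      ultimately show ?thesis by linarith
    qed
    have E1: "\<bar>negbin_below r n m - 1/2\<bar> \<le> D * f p / l * (C0 / l)"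
    proof -
      define H where "H t = - negbin_below r n t / D" for t
      have "\<bar>H 0 + H 1 - 2 * H m\<bar> \<le> C0 * (beta_kernel m l m / l\<^sup>2)"
      proof (rule med[OF m km l2k])
        show "continuous_on {0..1} H"
          unfolding H_def using continuous_on_negbin_below[of r n] r2 D
          by (intro continuous_intros) auto
        fix t :: real assume t: "0 < t" "t < 1"
        show "(H has_real_derivative beta_kernel m l t) (at t)"
          using DERIV_cdivide[OF DERIV_minus[OF DT[OF t]], of D] D
          by (simp add: H_def[abs_def] f_def)
      qed
      also have "\<dots> \<le> C0 * (2 * f p / l\<^sup>2)"
        using fm C0 unfolding f_def by (intro mult_left_mono divide_right_mono) auto
      also have "H 0 + H 1 - 2 * H m = (2 * negbin_below r n m - 1) / D"
        using n r2 by (simp add: H_def negbin_below_0 negbin_below_1 diff_divide_distrib)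
      finally have "\<bar>2 * negbin_below r n m - 1\<bar> \<le> D * (C0 * (2 * f p / l\<^sup>2))"
        using D by (simp add: field_simps)
      also have "\<dots> = 2 * (D * f p / l * (C0 / l))" by (simp add: power2_eq_square)
      finally show ?thesis by linarith
    qed
    have E2: "\<bar>negbin_below r n m - negbin_below r n p + D * f p * (m - p)\<bar>
        \<le> D * f p / l * (2 * b * B / (k * l))"
    proof -
      define G where "G t = negbin_below r n t + D * f p * t" for t
      have "norm (G m - G p) \<le> D * (f p * (2 * (b / (k * l)))) * norm (m - p)"
      proof (rule field_differentiable_bound[OF convex_closed_segment])
        fix t assume t: "t \<in> closed_segment p m"
        then have t01: "0 < t" "t < 1"
          using p m by (auto simp: closed_segment_eq_real_ivl split: if_splits)
        have "(G has_real_derivative - (D * f t) + D * f p) (at t)"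
          unfolding G_def by (intro DERIV_add DT t01 DERIV_cmult_Id)
        then show "(G has_real_derivative - (D * f t) + D * f p) (at t within closed_segment p m)"
          by (rule has_field_derivative_at_within)
        have "\<bar>- (D * f t) + D * f p\<bar> = D * \<bar>f t - f p\<bar>"
          using D by (simp add: abs_mult abs_minus_commute flip: right_diff_distrib)
        also have "\<dots> \<le> D * (f p * (2 * (b / (k * l))))"
          using ratio[OF t] D by (intro mult_left_mono) auto
        finally show "norm (- (D * f t) + D * f p) \<le> D * (f p * (2 * (b / (k * l))))" by simp
      qed auto
      also have "\<dots> \<le> D * (f p * (2 * (b / (k * l)))) * (B / l)"
        using mp_le D fpos[OF p] b0 k l by (intro mult_left_mono) auto
      also have "\<dots> = D * f p / l * (2 * b * B / (k * l))" by (simp add: mult_ac)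
      finally show ?thesis by (simp add: G_def algebra_simps)
    qed
    have E3: "\<bar>D * f p * (m - p) - M * \<delta>\<bar> \<le> M * (b / (p * l))"
    proof -
      have "m - p = q * \<delta> / l" using mp l by (simp add: field_simps)
      then have "D * f p * (m - p) = M * \<delta> * (real n / (p * l))"
        unfolding Dfp using q by simp
      moreover have "real n / (p * l) = (m - p + 1 / (3 * l)) / p + 1"
      proof -
        have "real n = l * m + 1/3" using l by (simp add: m_def)
        then show ?thesis using p l by (simp add: add_divide_distrib diff_divide_distrib)
      qed
      ultimately have "D * f p * (m - p) - M * \<delta> = M * (\<delta> * ((m - p + 1 / (3 * l)) / p))"
        by (simp add: distrib_left)
      then have "\<bar>D * f p * (m - p) - M * \<delta>\<bar> = M * \<bar>\<delta> * ((m - p + 1 / (3 * l)) / p)\<bar>"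
        using M by (simp only: abs_mult abs_of_pos)
      also have "\<bar>\<delta> * ((m - p + 1 / (3 * l)) / p)\<bar> \<le> B * ((B + 1) / l / p)"
      proof -
        have "\<bar>m - p + 1 / (3 * l)\<bar> \<le> B / l + 1 / (3 * l)"
          using mp_le l by (intro order_trans[OF abs_triangle_ineq]) simp
        also have "\<dots> \<le> (B + 1) / l" using l by (simp add: field_simps)
        finally have "\<bar>m - p + 1 / (3 * l)\<bar> / \<bar>p\<bar> \<le> (B + 1) / l / p"
          using p by (simp only: abs_of_pos divide_right_mono less_imp_le)
        then show ?thesis
          unfolding abs_mult abs_divide using near B unfolding \<delta>_def
          by (intro mult_mono) simp_all
      qed
      finally show ?thesis using M by (simp add: b_def mult_ac)
    qed
    have "\<bar>negbin_below r n p - 1/2 - M * \<delta>\<bar>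
        \<le> D * f p / l * (C0 / l) + D * f p / l * (2 * b * B / (k * l)) + M * (b / (p * l))"
      using E1 E2 E3 by linarith
    also have "\<dots> \<le> M / (p * q) * (C0 / l) + M / (p * q) * (2 * b * B / (k * l)) + M * (b / (p * l))"
      using Dfpl C0 l b0 B k p by (intro add_mono mult_right_mono) auto
    also have "\<dots> = C / l * M" by (simp add: C_def distrib_left add_divide_distrib mult_ac)
    also have "\<dots> \<le> C / (r / 2) * M"
      using C l r2 M by (intro mult_right_mono divide_left_mono) auto
    finally show ?thesis by (simp add: M_def \<delta>_def mult.commute)
  qed
  show ?thesis
  proof (rule that[of "2 * C" R])
    show "0 < 2 * C" "0 < R" using C by (simp_all add: R_def)
  qed (use main in \<open>simp add: q_def c_def\<close>)
qed

section \<open>The smoothed law and its median\<close>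

lemma median_between:
  assumes "prob_space M" and X: "X \<in> borel_measurable M"
    and a: "measure M {\<omega> \<in> space M. X \<omega> \<le> a} < 1/2"
    and b: "1/2 \<le> measure M {\<omega> \<in> space M. X \<omega> \<le> b}"
  shows "a \<le> median M X" "median M X \<le> b"
proof -
  interpret prob_space M by fact
  let ?S = "{x. 1/2 \<le> measure M {\<omega> \<in> space M. X \<omega> \<le> x}}"
  have lower: "a \<le> x" if "x \<in> ?S" for x
  proof (rule ccontr)
    assume "\<not> a \<le> x"
    then have "measure M {\<omega> \<in> space M. X \<omega> \<le> x} \<le> measure M {\<omega> \<in> space M. X \<omega> \<le> a}"
      using X by (intro finite_measure_mono) auto
    then show False using a that by simp
  qed
  show "a \<le> median M X"
    unfolding median_def using b lower by (intro cInf_greatest) auto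
  show "median M X \<le> b"
    unfolding median_def using b lower by (intro cInf_lower bdd_belowI[of _ a]) auto
qed

lemma measure_NegBin:
  assumes "0 < r" "0 < p" "p < 1" "finite A"
  shows "measure (NegBin r p) A = (\<Sum>k\<in>A. negbin_mass r p k)"
proof -
  interpret prob_space "NegBin r p" using assms by (intro prob_space_NegBin)
  have "emeasure (NegBin r p) {k} = ennreal (negbin_mass r p k)" for k
    by (simp add: NegBin_def emeasure_density nn_integral_indicator_singleton)
  then have "measure (NegBin r p) {k} = negbin_mass r p k" for k
    using assms by (simp add: measure_def negbin_mass_nonneg)
  then show ?thesis
    using finite_measure_eq_sum_singleton[OF assms(4)] by (simp add: NegBin_def)
qed

lemma measure_uniform_le:
  assumes "0 \<le> s" "s < 1"
  shows "measure (uniform_measure lborel {0<..<1::real}) {..s} = s"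
proof -
  have "{0<..<1} \<inter> {..s} = {0<..s}" using assms by auto
  then show ?thesis
    using assms by (subst measure_uniform_measure) auto
qed

text \<open>
  Up to a null set, \<open>K + U \<le> n + s\<close> means that \<open>K < n\<close>, or that
  \<open>K = n\<close> and \<open>U \<le> s\<close>.
\<close>

lemma NegBin_plus_uniform_cdf:
  fixes K :: "'a \<Rightarrow> nat" and U :: "'a \<Rightarrow> real"
  assumes M: "prob_space M" and r: "0 < r" and p: "0 < p" "p < 1"
    and K: "K \<in> measurable M (count_space UNIV)" and U: "U \<in> borel_measurable M"
    and dK: "distr M (count_space UNIV) K = NegBin r p"
    and dU: "distr M borel U = uniform_measure lborel {0<..<1}"
    and ind: "prob_space.indep_var M borel (\<lambda>\<omega>. real (K \<omega>)) borel U"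
    and s: "0 \<le> s" "s < 1"
  shows "measure M {\<omega> \<in> space M. real (K \<omega>) + U \<omega> \<le> real n + s}
    = negbin_below r n p + s * negbin_mass r p n"
proof -
  interpret prob_space M by fact
  note [measurable] = K U
  have PK: "prob (K -` A \<inter> space M) = (\<Sum>k\<in>A. negbin_mass r p k)" if "finite A" for A
    using measure_distr[OF K, of A] measure_NegBin[OF r p that] by (simp add: dK)
  have U01: "AE \<omega> in M. 0 < U \<omega> \<and> U \<omega> < 1"
  proof -
    have "AE x in distr M borel U. 0 < x \<and> x < 1"
      unfolding dU by (rule AE_uniform_measureI) auto
    then show ?thesis by (subst (asm) AE_distr_iff) auto
  qed
  let ?A = "K -` {..<n} \<inter> space M" and ?B = "(K -` {n} \<inter> space M) \<inter> (U -` {..s} \<inter> space M)"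
  have "prob {\<omega> \<in> space M. real (K \<omega>) + U \<omega> \<le> real n + s} = prob (?A \<union> ?B)"
  proof (rule measure_eq_AE)
    show "AE \<omega> in M. \<omega> \<in> {\<omega> \<in> space M. real (K \<omega>) + U \<omega> \<le> real n + s} \<longleftrightarrow> \<omega> \<in> ?A \<union> ?B"
      using U01
    proof eventually_elim
      fix \<omega> assume u: "0 < U \<omega> \<and> U \<omega> < 1"
      consider "K \<omega> < n" | "K \<omega> = n" | "n < K \<omega>" by linarith
      then show "\<omega> \<in> {\<omega> \<in> space M. real (K \<omega>) + U \<omega> \<le> real n + s} \<longleftrightarrow> \<omega> \<in> ?A \<union> ?B"
      proof cases
        case 1
        then have "real (K \<omega>) + 1 \<le> real n" by linarith
        then show ?thesis using u s 1 by auto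
      next
        case 3
        then have "real n + 1 \<le> real (K \<omega>)" by linarith
        then show ?thesis using u s 3 by auto
      qed auto
    qed
  qed measurable
  also have "\<dots> = prob ?A + prob ?B"
    by (rule finite_measure_Union) auto
  also have "prob ?A = negbin_below r n p"
    by (simp add: PK negbin_below_def)
  also have "prob ?B = s * negbin_mass r p n"
  proof -
    have "prob ((\<lambda>\<omega>. (real (K \<omega>), U \<omega>)) -` ({real n} \<times> {..s}) \<inter> space M)
        = prob ((\<lambda>\<omega>. real (K \<omega>)) -` {real n} \<inter> space M) * prob (U -` {..s} \<inter> space M)"
      by (rule indep_varD[OF ind]) auto
    moreover have "(\<lambda>\<omega>. (real (K \<omega>), U \<omega>)) -` ({real n} \<times> {..s}) \<inter> space M = ?B"
      "(\<lambda>\<omega>. real (K \<omega>)) -` {real n} \<inter> space M = K -` {n} \<inter> space M" by auto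
    moreover have "prob (U -` {..s} \<inter> space M) = s"
      using measure_distr[OF U, of "{..s}"] measure_uniform_le[OF s] by (simp add: dU)
    ultimately show ?thesis by (simp add: PK)
  qed
  finally show ?thesis .
qed

text \<open>
  By the expansion, the distribution function at \<open>y\<close> is \<open>1/2 + w * (y -
  x)\<close> up to \<open>w * C / r\<close>, where \<open>w > 0\<close> is the point mass at the
  integer part of \<open>y\<close>. At \<open>y = x - C' / r\<close> and \<open>y = x + C' /
  r\<close> with \<open>C' > C\<close> the linear term wins, so the distribution function crosses
  \<open>1/2\<close> in between.
\<close>

theorem theorem2:
  fixes p q :: real
  assumes "0 < p" and "p < 1" and "q = 1 - p"
  shows "\<exists>C>0. \<forall>(M :: real \<Rightarrow> 'a measure) (K :: real \<Rightarrow> 'a \<Rightarrow> nat) (U :: real \<Rightarrow> 'a \<Rightarrow> real).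
    (\<forall>r>0. prob_space (M r)
        \<and> K r \<in> measurable (M r) (count_space UNIV)
        \<and> U r \<in> borel_measurable (M r)
        \<and> distr (M r) (count_space UNIV) (K r) = NegBin r p
        \<and> distr (M r) borel (U r) = uniform_measure lborel {0<..<1}
        \<and> prob_space.indep_var (M r) borel (\<lambda>\<omega>. real (K r \<omega>)) borel (U r))
    \<longrightarrow> Limsup at_top (\<lambda>r. ereal \<bar>(median (M r) (\<lambda>\<omega>. real (K r \<omega>) + U r \<omega>) - r * p / q
              - (1 / 2 - (1 + p) / (6 * q))) / (1 / r)\<bar>) < ereal C"
proof -
  define c where "c = 1 / 2 - (1 + p) / (6 * q)"
  have q: "0 < q" using assms by simp
  obtain C R where C: "0 < C" and R: "0 < R" and expansion: "\<And>r n. R \<le> r \<Longrightarrow>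
      \<bar>real n - (r * p / q + c)\<bar> \<le> 2 \<Longrightarrow>
      \<bar>negbin_below r n p - 1/2 - negbin_mass r p n * (real n - (r * p / q + c))\<bar>
      \<le> C / r * negbin_mass r p n"
    using negbin_below_expansion[OF assms(1,2), of 2] unfolding c_def assms(3) by auto
  define C' where "C' = C + 1"
  show ?thesis
  proof (intro exI[of _ "C' + 1"] conjI allI impI)
    show "0 < C' + 1" using C by (simp add: C'_def)
    fix M :: "real \<Rightarrow> 'a measure" and K :: "real \<Rightarrow> 'a \<Rightarrow> nat" and U :: "real \<Rightarrow> 'a \<Rightarrow> real"
    assume hyp: "\<forall>r>0. prob_space (M r)
        \<and> K r \<in> measurable (M r) (count_space UNIV)
        \<and> U r \<in> borel_measurable (M r)
        \<and> distr (M r) (count_space UNIV) (K r) = NegBin r p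
        \<and> distr (M r) borel (U r) = uniform_measure lborel {0<..<1}
        \<and> prob_space.indep_var (M r) borel (\<lambda>\<omega>. real (K r \<omega>)) borel (U r)"
    have bound: "\<bar>(median (M r) (\<lambda>\<omega>. real (K r \<omega>) + U r \<omega>) - r * p / q - c) / (1 / r)\<bar> \<le> C'"
      if r: "R \<le> r" "C' \<le> r" "(1 + \<bar>c\<bar>) * q / p \<le> r" for r
    proof -
      define x where "x = r * p / q + c"
      have r0: "0 < r" using r R by simp
      have h: "prob_space (M r)" "K r \<in> measurable (M r) (count_space UNIV)"
        "U r \<in> borel_measurable (M r)" "distr (M r) (count_space UNIV) (K r) = NegBin r p"
        "distr (M r) borel (U r) = uniform_measure lborel {0<..<1}"
        "prob_space.indep_var (M r) borel (\<lambda>\<omega>. real (K r \<omega>)) borel (U r)"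
        using hyp r0 by blast+
      have x1: "1 \<le> x"
      proof -
        have "1 + \<bar>c\<bar> \<le> r * p / q" using r(3) assms(1) q by (simp add: field_simps)
        then show ?thesis unfolding x_def by linarith
      qed
      have d: "0 < C' / r" "C' / r \<le> 1" using r(2) r0 C by (simp_all add: C'_def)
      have cdf: "\<exists>w>0. \<bar>measure (M r) {\<omega> \<in> space (M r). real (K r \<omega>) + U r \<omega> \<le> y} - 1/2
          - w * (y - x)\<bar> \<le> C / r * w" if y: "\<bar>y - x\<bar> \<le> 1" for y
      proof -
        define n where "n = nat \<lfloor>y\<rfloor>"
        define s where "s = y - real n"
        have y0: "0 \<le> y" using y x1 by linarith
        then have n: "real n = of_int \<lfloor>y\<rfloor>" by (simp add: n_def)
        have s: "0 \<le> s" "s < 1" unfolding s_def n by linarith+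
        have "\<bar>real n - x\<bar> \<le> 2" using s y unfolding s_def by linarith
        then have "\<bar>negbin_below r n p - 1/2 - negbin_mass r p n * (real n - x)\<bar>
            \<le> C / r * negbin_mass r p n"
          using expansion[OF r(1)] unfolding x_def by blast
        moreover have "measure (M r) {\<omega> \<in> space (M r). real (K r \<omega>) + U r \<omega> \<le> y}
            = negbin_below r n p + s * negbin_mass r p n"
          using NegBin_plus_uniform_cdf[OF h(1) r0 assms(1,2) h(2-6) s, of n]
          by (simp add: s_def)
        moreover have "negbin_below r n p + s * negbin_mass r p n - 1/2 - negbin_mass r p n * (y - x)
            = negbin_below r n p - 1/2 - negbin_mass r p n * (real n - x)"
          by (simp add: s_def algebra_simps)
        moreover have "0 < negbin_mass r p n"
          using r0 assms(1,2) by (simp add: negbin_mass_eq_coeff negbin_coeff_pos)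
        ultimately show ?thesis by (intro exI[of _ "negbin_mass r p n"]) simp
      qed
      have near: "\<bar>x - C' / r - x\<bar> \<le> 1" "\<bar>x + C' / r - x\<bar> \<le> 1"
        using d by linarith+
      have lt: "C / r < C' / r" using r0 by (simp add: C'_def divide_strict_right_mono)
      have "measure (M r) {\<omega> \<in> space (M r). real (K r \<omega>) + U r \<omega> \<le> x - C' / r} < 1/2"
      proof -
        obtain w where w: "0 < w" "\<bar>measure (M r) {\<omega> \<in> space (M r). real (K r \<omega>) + U r \<omega> \<le> x - C' / r}
            - 1/2 - w * (x - C' / r - x)\<bar> \<le> C / r * w"
          using cdf[OF near(1)] by blast
        have "C / r * w < C' / r * w" using lt w(1) by (rule mult_strict_right_mono)
        moreover have "w * (x - C' / r - x) = - (C' / r * w)" by simp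
        ultimately show ?thesis using w(2) by linarith
      qed
      moreover have "1/2 \<le> measure (M r) {\<omega> \<in> space (M r). real (K r \<omega>) + U r \<omega> \<le> x + C' / r}"
      proof -
        obtain w where w: "0 < w" "\<bar>measure (M r) {\<omega> \<in> space (M r). real (K r \<omega>) + U r \<omega> \<le> x + C' / r}
            - 1/2 - w * (x + C' / r - x)\<bar> \<le> C / r * w"
          using cdf[OF near(2)] by blast
        have "C / r * w < C' / r * w" using lt w(1) by (rule mult_strict_right_mono)
        moreover have "w * (x + C' / r - x) = C' / r * w" by simp
        ultimately show ?thesis using w(2) by linarith
      qed
      moreover have "(\<lambda>\<omega>. real (K r \<omega>) + U r \<omega>) \<in> borel_measurable (M r)"
        using h(2,3) by measurable
      ultimately have "x - C' / r \<le> median (M r) (\<lambda>\<omega>. real (K r \<omega>) + U r \<omega>)"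
        "median (M r) (\<lambda>\<omega>. real (K r \<omega>) + U r \<omega>) \<le> x + C' / r"
        using median_between[OF h(1)] by blast+
      then have "\<bar>median (M r) (\<lambda>\<omega>. real (K r \<omega>) + U r \<omega>) - r * p / q - c\<bar> \<le> C' / r"
        unfolding x_def by linarith
      then show ?thesis using r0 by (simp add: abs_mult pos_le_divide_eq)
    qed
    have "Limsup at_top (\<lambda>r. ereal \<bar>(median (M r) (\<lambda>\<omega>. real (K r \<omega>) + U r \<omega>) - r * p / q - c)
        / (1 / r)\<bar>) \<le> ereal C'"
    proof (rule Limsup_bounded)
      show "\<forall>\<^sub>F r in at_top. ereal \<bar>(median (M r) (\<lambda>\<omega>. real (K r \<omega>) + U r \<omega>) - r * p / q - c)
          / (1 / r)\<bar> \<le> ereal C'"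
        using eventually_ge_at_top[of R] eventually_ge_at_top[of C']
          eventually_ge_at_top[of "(1 + \<bar>c\<bar>) * q / p"]
        by eventually_elim (simp only: ereal_less_eq bound)
    qed
    also have "\<dots> < ereal (C' + 1)" by simp
    finally show "Limsup at_top (\<lambda>r. ereal \<bar>(median (M r) (\<lambda>\<omega>. real (K r \<omega>) + U r \<omega>) - r * p / q
              - (1 / 2 - (1 + p) / (6 * q))) / (1 / r)\<bar>) < ereal (C' + 1)"
      unfolding c_def .
  qed
qed

end
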